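(* Let $R>0$, $Cu>0$, $b>0$, $\alpha>0$, $n<0$, $c\in(0,1)$, and suppose $$\left(1-\frac{\alpha+1}{n}\right)^{\frac{n-1-\alpha}{\alpha}}>\frac{1-c}{\alpha c}.$$ Let $F(\zeta)=\left[1-c+c\left(1+Cu^\alpha\zeta^\alpha\right)^{\frac{n-1}{\alpha}}\right]\zeta$ for $\zeta\ge0$ and let $\zeta_1$ be the first positive zero of $F'(\zeta)=0$. Then the boundary value problem $$\frac{1}{Y}\frac{d}{dY}\left\{\left[1-c+c\left(1+Cu^\alpha |U_Y|^\alpha\right)^{\frac{n-1}{\alpha}}\right]Y\,U_Y\right\}=b \quad\text{for } Y\in(0,R),\qquad U_Y(0)=U(R)=0,$$ has a unique classical solution if and only if $$\frac{bR}{2}\le\left[1-c+c\left(1+Cu^\alpha\zeta_1^\alpha\right)^{\frac{n-1}{\alpha}}\right]\zeta_1=F(\zeta_1).$$ Moreover, this solution $U$ satisfies $$U(Y)=-\int_Y^R F^{-1}\left(\frac{bs}{2}\right)ds,\qquad 0\le U_Y(Y)\le F^{-1}\left(\frac{bR}{2}\right)\quad\text{for } Y\in[0,R],$$ and $$0\le F^{-1}\left(\frac{bR}{2}\right)\le\zeta_1.$$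
   Context: $U=U(Y)$ is a real-valued function on $[0,R]$ and $U_Y=dU/dY$. $Cu$ is a single symbol (a real number, the Carreau number) and $Cu^\alpha$ denotes its $\alpha$-th power. A classical solution is a function $U\in C^2((0,R))\cap C^1([0,R])$ satisfying the equation pointwise in $(0,R)$ and the boundary conditions $U_Y(0)=U(R)=0$. Here $F^{-1}:[0,F(\zeta_1)]\to[0,\zeta_1]$ denotes the inverse of the strictly increasing restriction of $F$ to $[0,\zeta_1]$. *)

theory Defs
  imports "HOL-Analysis.Analysis"
begin

definition carreau_visc :: "real \<Rightarrow> real \<Rightarrow> real \<Rightarrow> real \<Rightarrow> real \<Rightarrow> real" where
  "carreau_visc c Cu \<alpha> n \<zeta> = 1 - c + c * (1 + Cu powr \<alpha> * \<zeta> powr \<alpha>) powr ((n - 1) / \<alpha>)"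

text \<open>Only meaningful for nonnegative arguments, since \<open>\<zeta> powr \<alpha>\<close> is taken without absolute value.\<close>

definition carreau_F :: "real \<Rightarrow> real \<Rightarrow> real \<Rightarrow> real \<Rightarrow> real \<Rightarrow> real" where
  "carreau_F c Cu \<alpha> n \<zeta> = carreau_visc c Cu \<alpha> n \<zeta> * \<zeta>"

definition first_positive_zero :: "(real \<Rightarrow> real) \<Rightarrow> real \<Rightarrow> bool" where
  "first_positive_zero g z \<longleftrightarrow> 0 < z \<and> g z = 0 \<and> (\<forall>x. 0 < x \<and> x < z \<longrightarrow> g x \<noteq> 0)"

text \<open>The derivative of \<open>U\<close> as a function on \<open>[0,R]\<close>: one-sided at the two end points, the usual
  derivative inside.\<close>

definition dY :: "real \<Rightarrow> (real \<Rightarrow> real) \<Rightarrow> real \<Rightarrow> real" where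
  "dY R U Y = vector_derivative U (at Y within {0..R})"

text \<open>The first two clauses say \<open>U \<in> C\<^sup>1([0,R])\<close>; together with them, the third says
  \<open>U \<in> C\<^sup>2((0,R))\<close>. Values of \<open>U\<close> outside \<open>[0,R]\<close> play no role.\<close>

definition classical_solution ::
  "real \<Rightarrow> real \<Rightarrow> real \<Rightarrow> real \<Rightarrow> real \<Rightarrow> real \<Rightarrow> (real \<Rightarrow> real) \<Rightarrow> bool" where
  "classical_solution R b c Cu \<alpha> n U \<longleftrightarrow>
     U differentiable_on {0..R} \<and> continuous_on {0..R} (dY R U) \<and>
     dY R U C1_differentiable_on {0<..<R} \<and>
     (\<forall>Y\<in>{0<..<R}. \<exists>D.
        ((\<lambda>y. carreau_visc c Cu \<alpha> n \<bar>dY R U y\<bar> * y * dY R U y) has_real_derivative D) (at Y) \<and>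
        1 / Y * D = b) \<and>
     dY R U 0 = 0 \<and> U R = 0"

text \<open>Solutions are functions on \<open>[0,R]\<close>, so uniqueness means agreement on \<open>[0,R]\<close>.\<close>

definition has_unique_classical_solution ::
  "real \<Rightarrow> real \<Rightarrow> real \<Rightarrow> real \<Rightarrow> real \<Rightarrow> real \<Rightarrow> bool" where
  "has_unique_classical_solution R b c Cu \<alpha> n \<longleftrightarrow>
     (\<exists>U. classical_solution R b c Cu \<alpha> n U \<and>
        (\<forall>V. classical_solution R b c Cu \<alpha> n V \<longrightarrow> (\<forall>Y\<in>{0..R}. V Y = U Y)))"

text \<open>The inverse of the restriction of \<open>F\<close> to \<open>[0,\<zeta>\<^sub>1]\<close>, where \<open>F\<close> is strictly increasing.\<close>

definition carreau_F_inv :: "real \<Rightarrow> real \<Rightarrow> real \<Rightarrow> real \<Rightarrow> real \<Rightarrow> real \<Rightarrow> real" where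
  "carreau_F_inv c Cu \<alpha> n \<zeta>\<^sub>1 = the_inv_into {0..\<zeta>\<^sub>1} (carreau_F c Cu \<alpha> n)"

end

theory Submission
  imports Defs
begin

text \<open>Multiplying the equation by \<open>Y\<close> and integrating from \<open>0\<close> turns it into a pointwise
  relation for \<open>p = U\<^sub>Y\<close>: the viscosity is positive, so \<open>p \<ge> 0\<close> and \<open>F (p Y) = b Y / 2\<close> on
  \<open>[0,R]\<close> (\<open>solution_flux\<close>). Since \<open>F\<close> is not injective on \<open>[0,\<infinity>)\<close>, the point is that \<open>p\<close>
  cannot leave the first increasing branch of \<open>F\<close>. If \<open>p\<close> took the critical value \<open>z = \<zeta>\<^sub>1\<close> at
  an interior point, differentiating the relation there would give \<open>F' z * p' = b / 2\<close>, which
  contradicts \<open>F' z = 0 < b\<close>; as \<open>p\<close> is continuous with \<open>p 0 = 0\<close>, it stays in \<open>[0,z]\<close>.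

  Hence every solution has \<open>b R / 2 = F (p R) \<le> F z\<close> and \<open>p Y = F\<^sup>-\<^sup>1 (b Y / 2)\<close>
  (\<open>solution_derivative\<close>): this gives necessity, uniqueness and the integral formula at once.
  Conversely, if \<open>b R / 2 \<le> F z\<close>, the integral formula defines a solution
  (\<open>solution_exists\<close>); its second derivative exists and is continuous on the open interval because
  there \<open>p\<close> takes values in \<open>(0,z)\<close>, where \<open>F'\<close> is positive.

  The hypothesis on the parameters says precisely that the minimum of \<open>F'\<close> is negative. As
  \<open>F'\<close> tends to \<open>1\<close> at \<open>0\<close>, it has a first zero, and it is positive before that zero.\<close>

section \<open>The flux function and its derivative\<close>

text \<open>Closed form of the derivative of \<open>F\<close>, with the right-hand limit \<open>1\<close> as its value at \<open>0\<close>,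
  so that the intermediate value theorem applies on closed intervals starting at \<open>0\<close>.\<close>

definition carreau_F' :: "real \<Rightarrow> real \<Rightarrow> real \<Rightarrow> real \<Rightarrow> real \<Rightarrow> real" where
  "carreau_F' c Cu \<alpha> n \<zeta> = 1 - c + c * (1 + Cu powr \<alpha> * \<zeta> powr \<alpha>) powr ((n - 1 - \<alpha>) / \<alpha>)
     * (1 + n * (Cu powr \<alpha> * \<zeta> powr \<alpha>))"

locale carreau =
  fixes c Cu \<alpha> n :: real
  assumes c_pos: "0 < c" and c_less_1: "c < 1" and \<alpha>_pos: "0 < \<alpha>"
begin

abbreviation "visc \<equiv> carreau_visc c Cu \<alpha> n"
abbreviation "F \<equiv> carreau_F c Cu \<alpha> n"
abbreviation "F' \<equiv> carreau_F' c Cu \<alpha> n"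

lemma visc_pos: "0 < visc \<zeta>"
proof -
  have "0 \<le> c * (1 + Cu powr \<alpha> * \<zeta> powr \<alpha>) powr ((n - 1) / \<alpha>)"
    using c_pos by simp
  then show ?thesis
    using c_less_1 unfolding carreau_visc_def by linarith
qed

lemma continuous_on_shear: "continuous_on {0..} (\<lambda>\<zeta>. Cu powr \<alpha> * \<zeta> powr \<alpha>)"
  using \<alpha>_pos by (intro continuous_on_mult continuous_on_const continuous_on_powr') auto

lemma continuous_on_shear_powr:
  "continuous_on {0..} (\<lambda>\<zeta>. (1 + Cu powr \<alpha> * \<zeta> powr \<alpha>) powr e)"
proof -
  have "1 + Cu powr \<alpha> * \<zeta> powr \<alpha> \<noteq> 0" for \<zeta>
    by (simp add: add_pos_nonneg less_imp_neq[symmetric])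
  then show ?thesis
    by (intro continuous_on_powr continuous_on_add continuous_on_const continuous_on_shear) simp
qed

lemma continuous_on_visc: "continuous_on {0..} visc"
  unfolding carreau_visc_def[abs_def] by (intro continuous_intros continuous_on_shear_powr)

lemma continuous_on_F: "continuous_on {0..} F"
  unfolding carreau_F_def[abs_def] by (intro continuous_intros continuous_on_visc)

lemma F_0 [simp]: "F 0 = 0"
  by (simp add: carreau_F_def)

lemma continuous_on_F': "continuous_on {0..} F'"
  unfolding carreau_F'_def[abs_def]
  by (intro continuous_on_add continuous_on_mult continuous_on_const
      continuous_on_shear continuous_on_shear_powr)

lemma DERIV_F:
  assumes "0 < \<zeta>"
  shows "(F has_real_derivative F' \<zeta>) (at \<zeta>)"
proof -
  define x where "x = Cu powr \<alpha> * \<zeta> powr \<alpha>"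
  define e where "e = (n - 1) / \<alpha>"
  have x: "0 \<le> x" by (simp add: x_def)
  have e\<alpha>: "e * \<alpha> = n - 1" using \<alpha>_pos by (simp add: e_def)
  have split: "(1 + x) powr e = (1 + x) powr (e - 1) * (1 + x)"
    using x by (simp add: powr_diff)
  have shift: "\<zeta> powr (\<alpha> - 1) * \<zeta> = \<zeta> powr \<alpha>"
    using assms by (simp add: powr_diff)
  have "((\<lambda>\<zeta>. (1 - c + c * (1 + Cu powr \<alpha> * \<zeta> powr \<alpha>) powr e) * \<zeta>) has_real_derivative
      c * (e * (1 + x) powr (e - 1) * (Cu powr \<alpha> * (\<alpha> * \<zeta> powr (\<alpha> - 1)))) * \<zeta>
      + (1 - c + c * (1 + x) powr e)) (at \<zeta>)"
    unfolding x_def using assms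
    by (auto intro!: derivative_eq_intros simp: add_pos_nonneg)
  also have "c * (e * (1 + x) powr (e - 1) * (Cu powr \<alpha> * (\<alpha> * \<zeta> powr (\<alpha> - 1)))) * \<zeta>
      = c * (1 + x) powr (e - 1) * (e * \<alpha>) * (Cu powr \<alpha> * (\<zeta> powr (\<alpha> - 1) * \<zeta>))"
    by (simp add: algebra_simps)
  also have "\<dots> = c * (1 + x) powr (e - 1) * (n - 1) * x"
    by (simp add: shift e\<alpha> x_def)
  also have "\<dots> + (1 - c + c * (1 + x) powr e) = 1 - c + c * (1 + x) powr (e - 1) * (1 + n * x)"
    unfolding split by (simp add: algebra_simps)
  also have "e - 1 = (n - 1 - \<alpha>) / \<alpha>"
    using \<alpha>_pos by (simp add: e_def field_simps)
  finally show ?thesis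
    by (simp add: carreau_F_def[abs_def] carreau_visc_def carreau_F'_def x_def e_def)
qed

lemma F'_0: "F' 0 = 1"
  using \<alpha>_pos by (simp add: carreau_F'_def)

text \<open>In the variable \<open>x = (Cu \<zeta>)\<^sup>\<alpha>\<close> the derivative \<open>F'\<close> is
  \<open>1 - c + c (1 + x) powr ((n - 1 - \<alpha>) / \<alpha>) (1 + n x)\<close>, whose derivative in \<open>x\<close> is a
  positive multiple of \<open>(n - 1) (1 + \<alpha> + n x)\<close>. So \<open>F'\<close> is smallest at \<open>x = - (\<alpha> + 1) / n\<close>, and
  \<open>cond\<close> is the statement that this minimum is negative.\<close>

lemma F'_negative_somewhere:
  assumes "0 < Cu" and "n < 0"
    and cond: "(1 - (\<alpha> + 1) / n) powr ((n - 1 - \<alpha>) / \<alpha>) > (1 - c) / (\<alpha> * c)"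
  obtains \<zeta> where "0 < \<zeta>" and "F' \<zeta> < 0"
proof
  define x where "x = - (\<alpha> + 1) / n"
  define \<zeta> where "\<zeta> = x powr (1 / \<alpha>) / Cu"
  have x: "0 < x" using assms \<alpha>_pos by (simp add: x_def divide_pos_neg field_simps)
  show "0 < \<zeta>" using x \<open>0 < Cu\<close> by (simp add: \<zeta>_def)
  have "Cu powr \<alpha> * \<zeta> powr \<alpha> = (Cu * \<zeta>) powr \<alpha>"
    using \<open>0 < Cu\<close> \<open>0 < \<zeta>\<close> by (simp add: powr_mult)
  also have "\<dots> = x"
    using \<open>0 < Cu\<close> x \<alpha>_pos by (simp add: \<zeta>_def powr_powr)
  finally have *: "Cu powr \<alpha> * \<zeta> powr \<alpha> = x" .
  have nx: "1 + n * x = - \<alpha>" using \<open>n < 0\<close> by (simp add: x_def)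
  have "F' \<zeta> = 1 - c - c * (1 + x) powr ((n - 1 - \<alpha>) / \<alpha>) * \<alpha>"
    unfolding carreau_F'_def * nx by simp
  moreover have "1 - c < (1 + x) powr ((n - 1 - \<alpha>) / \<alpha>) * (\<alpha> * c)"
  proof -
    have "1 - (\<alpha> + 1) / n = 1 + x"
      by (simp add: x_def minus_divide_left[symmetric] del: minus_add_distrib)
    with cond have "(1 - c) / (\<alpha> * c) < (1 + x) powr ((n - 1 - \<alpha>) / \<alpha>)" by metis
    then show ?thesis using \<alpha>_pos c_pos by (simp add: divide_less_eq)
  qed
  ultimately show "F' \<zeta> < 0" by (simp add: algebra_simps)
qed

text \<open>The zero is found as the infimum of the closed set where \<open>F' \<le> 0\<close>, which yields positivity
  of \<open>F'\<close> before it, not just the absence of zeros.\<close>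

lemma ex_first_zero_F':
  assumes "0 < \<zeta>" and "F' \<zeta> < 0"
  obtains z where "0 < z" and "F' z = 0" and "\<And>x. 0 \<le> x \<Longrightarrow> x < z \<Longrightarrow> 0 < F' x"
proof -
  define S where "S = {0..\<zeta>} \<inter> F' -` {..0}"
  have cont: "continuous_on {0..\<zeta>} F'"
    using continuous_on_F' by (rule continuous_on_subset) auto
  have "closed S"
    unfolding S_def using cont by (intro continuous_closed_preimage) auto
  moreover have "\<zeta> \<in> S" "bdd_below S"
    using assms by (auto simp: S_def intro: bdd_belowI[of _ 0])
  ultimately have z: "Inf S \<in> S"
    by (intro closed_contains_Inf) auto
  have before: "0 < F' x" if "0 \<le> x" "x < Inf S" for x
  proof (rule ccontr)
    assume "\<not> 0 < F' x"
    with that z have "x \<in> S" by (auto simp: S_def)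
    with \<open>bdd_below S\<close> have "Inf S \<le> x" by (intro cInf_lower)
    with that show False by simp
  qed
  have pos: "0 < Inf S"
    using z F'_0 by (cases "Inf S = 0") (auto simp: S_def)
  have "F' (Inf S) = 0"
  proof (rule ccontr)
    assume "F' (Inf S) \<noteq> 0"
    with z have neg: "F' (Inf S) < 0" by (auto simp: S_def)
    have "continuous_on {0..Inf S} F'"
      using continuous_on_F' by (rule continuous_on_subset) auto
    then obtain x where "0 \<le> x" "x \<le> Inf S" "F' x = 0"
      using IVT2'[of F' "Inf S" 0 0] neg pos F'_0 by auto
    with before[of x] neg show False by (cases "x = Inf S") auto
  qed
  with that pos before show thesis by blast
qed

section \<open>Integrating the equation once\<close>

text \<open>The flux \<open>visc \<bar>p\<bar> Y p\<close> has derivative \<open>b Y\<close> and vanishes at \<open>Y = 0\<close>, so it equals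
  \<open>b Y\<^sup>2 / 2\<close>; this fixes the sign of \<open>p\<close>, and the absolute value disappears.\<close>

lemma solution_flux:
  assumes "0 < R" and "0 < b" and U: "classical_solution R b c Cu \<alpha> n U" and Y: "Y \<in> {0..R}"
  shows "0 \<le> dY R U Y" and "F (dY R U Y) = b * Y / 2"
proof -
  define p where "p = dY R U"
  (* The first integral; the term in b makes it constant along solutions. *)
  define \<Phi> where "\<Phi> y = visc \<bar>p y\<bar> * y * p y - b * y\<^sup>2 / 2" for y
  have p: "continuous_on {0..R} p" and p0: "p 0 = 0"
    using U by (auto simp: classical_solution_def p_def)
  have "continuous_on {0..R} (\<lambda>y. visc \<bar>p y\<bar>)"
    using p by (intro continuous_on_compose2[OF continuous_on_visc] continuous_intros) auto
  then have cont: "continuous_on {0..R} \<Phi>"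
    unfolding \<Phi>_def by (intro continuous_intros p) simp_all
  have deriv: "(\<Phi> has_real_derivative 0) (at y)" if y: "0 < y" "y < R" for y
  proof -
    obtain D where D: "((\<lambda>y. visc \<bar>p y\<bar> * y * p y) has_real_derivative D) (at y)" "1 / y * D = b"
      using U y unfolding classical_solution_def p_def by fastforce
    have "D = b * y" using D(2) y by (simp add: field_simps)
    have "((\<lambda>y. b * y\<^sup>2 / 2) has_real_derivative b * y) (at y)"
      by (auto intro!: derivative_eq_intros)
    from DERIV_diff[OF D(1) this] show ?thesis
      unfolding \<Phi>_def by (simp add: \<open>D = b * y\<close>)
  qed
  have "visc \<bar>p Y\<bar> * p Y = b * Y / 2"
  proof (cases "Y = 0")
    case False
    with Y have "0 < Y" "Y \<le> R" by auto
    have "\<Phi> Y = \<Phi> 0"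
      by (rule DERIV_isconst2[OF \<open>0 < R\<close> cont deriv]) (use Y in simp_all)
    then have "Y * (visc \<bar>p Y\<bar> * p Y) = Y * (b * Y / 2)"
      by (simp add: \<Phi>_def power2_eq_square algebra_simps)
    with \<open>0 < Y\<close> show ?thesis by simp
  qed (simp add: p0)
  moreover have "0 \<le> b * Y / 2"
    using Y \<open>0 < b\<close> by simp
  ultimately have "0 \<le> visc \<bar>p Y\<bar> * p Y"
    by (simp only:)
  then have "0 \<le> p Y"
    using visc_pos[of "\<bar>p Y\<bar>"] by (simp add: zero_le_mult_iff)
  with \<open>visc \<bar>p Y\<bar> * p Y = b * Y / 2\<close> show "0 \<le> dY R U Y" "F (dY R U Y) = b * Y / 2"
    by (simp_all add: carreau_F_def p_def)
qed

end

section \<open>The increasing branch and its inverse\<close>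

locale carreau_first_zero = carreau +
  fixes z :: real
  assumes z_pos: "0 < z" and F'_z: "F' z = 0"
    and F'_pos: "\<And>x. 0 \<le> x \<Longrightarrow> x < z \<Longrightarrow> 0 < F' x"
begin

abbreviation "Finv \<equiv> carreau_F_inv c Cu \<alpha> n z"

lemma first_positive_zero_deriv_F: "first_positive_zero (deriv F) z"
proof -
  have "deriv F x = F' x" if "0 < x" for x
    using DERIV_F[OF that] by (rule DERIV_imp_deriv)
  then show ?thesis
    using z_pos F'_z F'_pos by (auto simp: first_positive_zero_def less_imp_neq[symmetric])
qed

lemma F_strict_mono: "strict_mono_on {0..z} F"
proof (rule strict_mono_onI)
  fix r s assume rs: "r \<in> {0..z}" "s \<in> {0..z}" "r < s"
  show "F r < F s"
  proof (rule DERIV_pos_imp_increasing_open[OF \<open>r < s\<close>])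
    show "continuous_on {r..s} F"
      using continuous_on_F by (rule continuous_on_subset) (use rs in auto)
    show "\<exists>y. (F has_real_derivative y) (at x) \<and> 0 < y" if "r < x" "x < s" for x
      using DERIV_F[of x] F'_pos[of x] rs that by auto
  qed
qed

lemma F_inj: "inj_on F {0..z}"
  using F_strict_mono by (rule strict_mono_on_imp_inj_on)

lemma Finv_F: "x \<in> {0..z} \<Longrightarrow> Finv (F x) = x"
  using F_inj by (simp add: carreau_F_inv_def the_inv_into_f_f)

lemma F_image: "F ` {0..z} = {0..F z}"
proof
  show "F ` {0..z} \<subseteq> {0..F z}"
    using strict_mono_onD[OF F_strict_mono, of 0] strict_mono_onD[OF F_strict_mono, of _ z] z_pos
    by (fastforce simp: le_less)
  show "{0..F z} \<subseteq> F ` {0..z}"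
  proof
    fix y assume "y \<in> {0..F z}"
    moreover have "continuous_on {0..z} F"
      using continuous_on_F by (rule continuous_on_subset) auto
    ultimately show "y \<in> F ` {0..z}"
      using IVT'[of F 0 y z] z_pos by fastforce
  qed
qed

lemma
  assumes "y \<in> {0..F z}"
  shows F_Finv: "F (Finv y) = y" and Finv_range: "Finv y \<in> {0..z}"
  using assms F_inj unfolding F_image[symmetric] carreau_F_inv_def
  by (auto simp: the_inv_into_f_f)

lemma Finv_mono:
  assumes "0 \<le> x" "x \<le> y" "y \<le> F z"
  shows "Finv x \<le> Finv y"
proof -
  have "x \<in> {0..F z}" "y \<in> {0..F z}" using assms by auto
  then show ?thesis
    using F_Finv Finv_range strict_mono_onD[OF F_strict_mono, of "Finv y" "Finv x"] assms
    by (metis not_le order.strict_iff_not)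
qed

lemma Finv_open_range:
  assumes "0 < y" "y < F z"
  shows "0 < Finv y" "Finv y < z"
  using F_Finv[of y] Finv_range[of y] assms by (auto simp: order.strict_iff_order)

lemma continuous_on_Finv: "continuous_on {0..F z} Finv"
  unfolding F_image[symmetric]
  using continuous_on_subset[OF continuous_on_F] Finv_F
  by (intro continuous_on_inv) auto

lemma DERIV_Finv:
  assumes y: "0 < y" "y < F z"
  shows "(Finv has_real_derivative inverse (F' (Finv y))) (at y)"
proof (rule DERIV_inverse_function[of F _ _ _ 0 "F z"])
  show "(F has_real_derivative F' (Finv y)) (at (Finv y))"
    using Finv_open_range[OF y] by (intro DERIV_F)
  show "F' (Finv y) \<noteq> 0"
    using Finv_open_range[OF y] F'_pos[of "Finv y"] by simp
  show "isCont Finv y"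
    using continuous_on_Finv y by (intro continuous_on_interior[of "{0..F z}"]) auto
qed (use y F_Finv in auto)

section \<open>Solutions of the boundary value problem\<close>

text \<open>Differentiating \<open>F (p Y) = b Y / 2\<close> at an interior point with \<open>p Y = z\<close> would give
  \<open>0 = b / 2\<close>. So \<open>p\<close> cannot pass \<open>z\<close>; the relation can be inverted on the increasing branch,
  and at \<open>Y = R\<close> it bounds \<open>b R / 2\<close> by \<open>F z\<close>.\<close>

lemma solution_derivative:
  assumes "0 < R" and "0 < b" and U: "classical_solution R b c Cu \<alpha> n U" and Y: "Y \<in> {0..R}"
  shows "dY R U Y = Finv (b * Y / 2)" and "b * R / 2 \<le> F z"
proof -
  define p where "p = dY R U"
  note flux = solution_flux[OF \<open>0 < R\<close> \<open>0 < b\<close> U, folded p_def]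
  have cont: "continuous_on {0..R} p" and p0: "p 0 = 0"
    using U by (auto simp: classical_solution_def p_def)
  have no_hit: "p y \<noteq> z" if y: "y \<in> {0<..<R}" for y
  proof
    assume hit: "p y = z"
    have "p C1_differentiable_on {0<..<R}"
      using U by (simp add: classical_solution_def p_def)
    then obtain D where D: "(p has_real_derivative D) (at y)"
      using y unfolding C1_differentiable_on_def has_real_derivative_iff_has_vector_derivative
      by blast
    have "((\<lambda>y. F (p y)) has_real_derivative F' z * D) (at y)"
      using DERIV_chain2[of F "F' z" p y D] DERIV_F[OF z_pos] D hit by simp
    then have "((\<lambda>y. b * y / 2) has_real_derivative F' z * D) (at y)"
      by (rule has_field_derivative_transform_within_open[where S = "{0<..<R}"])
        (use y flux(2) in auto)
    moreover have "((\<lambda>y. b * y / 2) has_real_derivative b / 2) (at y)"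
      by (auto intro!: derivative_eq_intros)
    ultimately have "F' z * D = b / 2" by (rule DERIV_unique)
    with F'_z \<open>0 < b\<close> show False by simp
  qed
  have inside: "p y \<le> z" if y: "y \<in> {0..R}" for y
  proof (rule ccontr)
    assume "\<not> p y \<le> z"
    then have "z < p y" by simp
    moreover have "continuous_on {0..y} p"
      using cont by (rule continuous_on_subset) (use y in auto)
    ultimately obtain x where x: "0 \<le> x" "x \<le> y" "p x = z"
      using IVT'[of p 0 z y] p0 z_pos y by auto
    then have "x \<noteq> 0" "x \<noteq> y" using p0 z_pos \<open>z < p y\<close> by auto
    with x y no_hit[of x] show False by auto
  qed
  have range: "p y \<in> {0..z}" if "y \<in> {0..R}" for y
    using inside flux(1) that by auto
  show "dY R U Y = Finv (b * Y / 2)"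
    using Finv_F[OF range[OF Y]] unfolding flux(2)[OF Y] by (simp add: p_def)
  have "F (p R) \<in> {0..F z}"
    unfolding F_image[symmetric] using range[of R] \<open>0 < R\<close> by simp
  with flux(2)[of R] \<open>0 < R\<close> show "b * R / 2 \<le> F z" by simp
qed

lemma solution_formula:
  assumes "0 < R" and "0 < b" and U: "classical_solution R b c Cu \<alpha> n U" and Y: "Y \<in> {0..R}"
  shows "(\<lambda>s. Finv (b * s / 2)) integrable_on {Y..R}"
    and "U Y = - integral {Y..R} (\<lambda>s. Finv (b * s / 2))"
proof -
  have "U differentiable_on {0..R}" "U R = 0"
    using U by (auto simp: classical_solution_def)
  have "(U has_vector_derivative Finv (b * s / 2)) (at s within {Y..R})" if "s \<in> {Y..R}" for s
  proof -
    have s: "s \<in> {0..R}" using that Y by auto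
    then have "(U has_vector_derivative dY R U s) (at s within {0..R})"
      using \<open>U differentiable_on {0..R}\<close>
      by (simp add: dY_def differentiable_on_def vector_derivative_works)
    then have "(U has_vector_derivative dY R U s) (at s within {Y..R})"
      by (rule has_vector_derivative_within_subset) (use Y in auto)
    then show ?thesis
      using solution_derivative(1)[OF assms(1-3) s] by simp
  qed
  then have "((\<lambda>s. Finv (b * s / 2)) has_integral U R - U Y) {Y..R}"
    using Y by (intro fundamental_theorem_of_calculus) auto
  with \<open>U R = 0\<close> show "(\<lambda>s. Finv (b * s / 2)) integrable_on {Y..R}"
    "U Y = - integral {Y..R} (\<lambda>s. Finv (b * s / 2))"
    by (auto simp: has_integral_iff)
qed

text \<open>When \<open>b R / 2 = F z\<close>, the second derivative blows up at the end point \<open>R\<close>, where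
  \<open>F' (p R) = 0\<close>. This is harmless: second derivatives are only required on the open interval,
  where \<open>b Y / 2 < F z\<close> holds strictly.\<close>

lemma solution_exists:
  assumes "0 < R" and "0 < b" and le: "b * R / 2 \<le> F z"
  shows "\<exists>U. classical_solution R b c Cu \<alpha> n U"
proof
  define p where "p s = Finv (b * s / 2)" for s
  define U where "U Y = integral {0..Y} p - integral {0..R} p" for Y
  have range: "b * Y / 2 \<in> {0..F z}" if "Y \<in> {0..R}" for Y
  proof -
    have "b * Y \<le> b * R" using that \<open>0 < b\<close> by simp
    moreover have "0 \<le> b * Y" using that \<open>0 < b\<close> by simp
    ultimately show ?thesis using le unfolding atLeastAtMost_iff by linarith
  qed
  have range_open: "0 < b * Y / 2" "b * Y / 2 < F z" if "Y \<in> {0<..<R}" for Y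
  proof -
    have "b * Y < b * R" using that \<open>0 < b\<close> by simp
    moreover have "0 < b * Y" using that \<open>0 < b\<close> by simp
    ultimately show "0 < b * Y / 2" "b * Y / 2 < F z" using le by linarith+
  qed
  have p: "continuous_on {0..R} p"
    unfolding p_def
    by (intro continuous_on_compose2[OF continuous_on_Finv] continuous_intros) (use range in auto)
  have U': "(U has_vector_derivative p Y) (at Y within {0..R})" if "Y \<in> {0..R}" for Y
    unfolding U_def
    using integral_has_vector_derivative[OF p that] by (auto intro!: derivative_eq_intros)
  have dY: "dY R U Y = p Y" if "Y \<in> {0..R}" for Y
    unfolding dY_def using U'[OF that] that \<open>0 < R\<close>
    by (intro vector_derivative_within_closed_interval) auto
  define q where "q Y = inverse (F' (p Y)) * (b / 2)" for Y
  have q: "(dY R U has_vector_derivative q Y) (at Y)" if Y: "Y \<in> {0<..<R}" for Y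
  proof -
    have "(p has_real_derivative q Y) (at Y)"
      unfolding p_def q_def
      by (rule DERIV_chain2[where f = Finv and g = "\<lambda>s. b * s / 2",
            OF DERIV_Finv[OF range_open[OF Y]]])
        (auto intro!: derivative_eq_intros)
    then have "(p has_vector_derivative q Y) (at Y)"
      by (simp add: has_real_derivative_iff_has_vector_derivative)
    then show ?thesis
      by (rule has_vector_derivative_transform_within_open[where S = "{0<..<R}"])
        (use Y dY in auto)
  qed
  have "continuous_on {0<..<R} q"
    unfolding q_def
  proof (intro continuous_intros ballI)
    have "p Y \<in> {0..}" "F' (p Y) \<noteq> 0" if "Y \<in> {0<..<R}" for Y
      using Finv_open_range[OF range_open[OF that]] F'_pos[of "p Y"] by (auto simp: p_def)
    then show "continuous_on {0<..<R} (\<lambda>Y. F' (p Y))" "\<And>Y. Y \<in> {0<..<R} \<Longrightarrow> F' (p Y) \<noteq> 0"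
      using continuous_on_subset[OF p, of "{0<..<R}"]
        greaterThanLessThan_subseteq_atLeastAtMost_iff[of 0 R 0 R]
      by (auto intro!: continuous_on_compose2[OF continuous_on_F'])
  qed
  with q have C1: "dY R U C1_differentiable_on {0<..<R}"
    unfolding C1_differentiable_on_def by blast
  have eq: "((\<lambda>y. visc \<bar>dY R U y\<bar> * y * dY R U y) has_real_derivative b * Y) (at Y)"
    if Y: "Y \<in> {0<..<R}" for Y
  proof (rule has_field_derivative_transform_within_open[where S = "{0<..<R}"])
    show "((\<lambda>y. b * y\<^sup>2 / 2) has_real_derivative b * Y) (at Y)"
      by (auto intro!: derivative_eq_intros)
    fix y assume y: "y \<in> {0<..<R}"
    have "0 < p y" "F (p y) = b * y / 2"
      using Finv_open_range[OF range_open[OF y]] F_Finv[of "b * y / 2"] range_open[OF y]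
      by (auto simp: p_def)
    then show "b * y\<^sup>2 / 2 = visc \<bar>dY R U y\<bar> * y * dY R U y"
      using y dY by (simp add: carreau_F_def power2_eq_square algebra_simps)
  qed (use Y in auto)
  have "p 0 = 0"
    using Finv_F[of 0] z_pos by (simp add: p_def)
  show "classical_solution R b c Cu \<alpha> n U"
    unfolding classical_solution_def
  proof (intro conjI ballI)
    show "U differentiable_on {0..R}"
      unfolding differentiable_on_def using U' differentiableI_vector by blast
    show "continuous_on {0..R} (dY R U)"
      using p by (rule continuous_on_eq) (simp add: dY)
    show "dY R U 0 = 0" using dY[of 0] \<open>p 0 = 0\<close> \<open>0 < R\<close> by simp
    show "U R = 0" by (simp add: U_def)
    show "\<exists>D. ((\<lambda>y. visc \<bar>dY R U y\<bar> * y * dY R U y) has_real_derivative D) (at Y) \<and>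
        1 / Y * D = b" if "Y \<in> {0<..<R}" for Y
      using eq[OF that] that by (intro exI[of _ "b * Y"]) auto
  qed (fact C1)
qed

lemma unique_solution_iff:
  assumes "0 < R" and "0 < b"
  shows "has_unique_classical_solution R b c Cu \<alpha> n \<longleftrightarrow> b * R / 2 \<le> F z"
proof
  assume "has_unique_classical_solution R b c Cu \<alpha> n"
  then obtain U where "classical_solution R b c Cu \<alpha> n U"
    by (auto simp: has_unique_classical_solution_def)
  from solution_derivative(2)[OF assms this, of 0] show "b * R / 2 \<le> F z"
    using \<open>0 < R\<close> by simp
next
  assume "b * R / 2 \<le> F z"
  from solution_exists[OF assms this] show "has_unique_classical_solution R b c Cu \<alpha> n"
    unfolding has_unique_classical_solution_def using solution_formula(2)[OF assms] by metis
qed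

end

theorem theorem2p4:
  fixes R Cu b \<alpha> n c :: real
  assumes "R > 0" and "Cu > 0" and "b > 0" and "\<alpha> > 0" and "n < 0" and "0 < c" and "c < 1"
    and "(1 - (\<alpha> + 1) / n) powr ((n - 1 - \<alpha>) / \<alpha>) > (1 - c) / (\<alpha> * c)"
  shows "\<exists>\<zeta>\<^sub>1. first_positive_zero (deriv (carreau_F c Cu \<alpha> n)) \<zeta>\<^sub>1 \<and>
    (has_unique_classical_solution R b c Cu \<alpha> n \<longleftrightarrow> b * R / 2 \<le> carreau_F c Cu \<alpha> n \<zeta>\<^sub>1) \<and>
    (b * R / 2 \<le> carreau_F c Cu \<alpha> n \<zeta>\<^sub>1 \<longrightarrow>
      (\<forall>U. classical_solution R b c Cu \<alpha> n U \<longrightarrow>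
        (\<forall>Y\<in>{0..R}.
          (\<lambda>s. carreau_F_inv c Cu \<alpha> n \<zeta>\<^sub>1 (b * s / 2)) integrable_on {Y..R} \<and>
          U Y = - integral {Y..R} (\<lambda>s. carreau_F_inv c Cu \<alpha> n \<zeta>\<^sub>1 (b * s / 2)) \<and>
          0 \<le> dY R U Y \<and> dY R U Y \<le> carreau_F_inv c Cu \<alpha> n \<zeta>\<^sub>1 (b * R / 2))) \<and>
      0 \<le> carreau_F_inv c Cu \<alpha> n \<zeta>\<^sub>1 (b * R / 2) \<and>
      carreau_F_inv c Cu \<alpha> n \<zeta>\<^sub>1 (b * R / 2) \<le> \<zeta>\<^sub>1)"
proof -
  interpret carreau c Cu \<alpha> n
    by unfold_locales (use assms in auto)
  obtain \<zeta> where "0 < \<zeta>" "F' \<zeta> < 0"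
    using F'_negative_somewhere[OF \<open>Cu > 0\<close> \<open>n < 0\<close> assms(8)] .
  then obtain z where z: "0 < z" "F' z = 0" "\<And>x. 0 \<le> x \<Longrightarrow> x < z \<Longrightarrow> 0 < F' x"
    using ex_first_zero_F' by blast
  interpret carreau_first_zero c Cu \<alpha> n z
    by unfold_locales (fact z)+
  have bound: "dY R U Y \<le> Finv (b * R / 2)"
    if "classical_solution R b c Cu \<alpha> n U" "Y \<in> {0..R}" for U Y
    using solution_derivative[OF \<open>R > 0\<close> \<open>b > 0\<close> that] that(2) \<open>b > 0\<close>
      Finv_mono[of "b * Y / 2" "b * R / 2"] by simp
  have "Finv (b * R / 2) \<in> {0..z}" if "b * R / 2 \<le> F z"
    using that \<open>R > 0\<close> \<open>b > 0\<close> by (intro Finv_range) simp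
  then show ?thesis
    using first_positive_zero_deriv_F unique_solution_iff[OF \<open>R > 0\<close> \<open>b > 0\<close>] bound
      solution_formula[OF \<open>R > 0\<close> \<open>b > 0\<close>] solution_flux(1)[OF \<open>R > 0\<close> \<open>b > 0\<close>]
    by (intro exI[of _ z]) auto
qed

end
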